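(* Let $G$ be a twin-free finite simple graph with no isolated vertices and let $t \in \mathbb{N}$. (i) If $G = K_2$, then $\det(G) = 1$ and $\det(\mu^{(t)}(G)) = 2$. (ii) If $G \neq K_2$, then any minimum size determining set for $G$ (viewed as a set of level-$0$ vertices of $\mu^{(t)}(G)$) is a minimum size determining set for $\mu^{(t)}(G)$, and $\det(\mu^{(t)}(G)) = \det(G)$.
   Context: For $t \in \mathbb{N}$ and a graph $G$ with $V(G)=\{v_1,\dots,v_n\}$, the generalized Mycielskian $\mu^{(t)}(G)$ has vertex set $\{u_i^s : 1\le i\le n,\ 0\le s\le t\} \cup \{w\}$, with $u_i^0$ identified with $v_i$ (so $G$ is the induced subgraph on level $0$). For each edge $v_iv_j$ of $G$ it has edges $u_i^0u_j^0$ and $u_i^su_j^{s+1}$, $u_j^su_i^{s+1}$ for $0 \le s < t$; also edges $u_i^t w$ for $1 \le i \le n$; no other edges. A set $S$ of vertices of a graph $H$ is a determining set if the only automorphism of $H$ fixing every vertex of $S$ is the identity; $\det(H)$ is the minimum size of a determining set. Two vertices are twins if they have the same open neighborhood; a graph is twin-free if it has no pair of distinct twins. *)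

theory Defs
  imports "Graph_Theory.Kuratowski"
begin

text \<open>
  Finite simple graphs are the locale \<open>pair_graph\<close>: an edge \<open>uv\<close> is represented by the
  two arcs \<open>(u, v)\<close> and \<open>(v, u)\<close>.  The complete graph \<open>K\<^sub>n\<close>, up to isomorphism, is
  \<open>complete_digraph n\<close>.
\<close>

definition nbhd :: "'a pair_pre_digraph \<Rightarrow> 'a \<Rightarrow> 'a set" where
  "nbhd G v = {u. (v, u) \<in> parcs G}"

definition isolated :: "'a pair_pre_digraph \<Rightarrow> 'a \<Rightarrow> bool" where
  "isolated G v \<longleftrightarrow> v \<in> pverts G \<and> nbhd G v = {}"

definition twins :: "'a pair_pre_digraph \<Rightarrow> 'a \<Rightarrow> 'a \<Rightarrow> bool" where
  "twins G u v \<longleftrightarrow> u \<in> pverts G \<and> v \<in> pverts G \<and> nbhd G u = nbhd G v"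

definition twin_free :: "'a pair_pre_digraph \<Rightarrow> bool" where
  "twin_free G \<longleftrightarrow> \<not> (\<exists>u v. u \<noteq> v \<and> twins G u v)"

text \<open>
  An automorphism is a total function of which only the values on \<open>pverts G\<close> matter;
  accordingly, being the identity means being the identity on \<open>pverts G\<close>.
\<close>

definition automorphism :: "'a pair_pre_digraph \<Rightarrow> ('a \<Rightarrow> 'a) \<Rightarrow> bool" where
  "automorphism G f \<longleftrightarrow> bij_betw f (pverts G) (pverts G) \<and>
     (\<forall>u \<in> pverts G. \<forall>v \<in> pverts G. (f u, f v) \<in> parcs G \<longleftrightarrow> (u, v) \<in> parcs G)"

definition determining_set :: "'a pair_pre_digraph \<Rightarrow> 'a set \<Rightarrow> bool" where
  "determining_set G S \<longleftrightarrow> S \<subseteq> pverts G \<and>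
     (\<forall>f. automorphism G f \<and> (\<forall>x \<in> S. f x = x) \<longrightarrow> (\<forall>x \<in> pverts G. f x = x))"

definition determining_number :: "'a pair_pre_digraph \<Rightarrow> nat" where
  "determining_number G = (LEAST k. \<exists>S. determining_set G S \<and> card S = k)"

definition minimum_determining_set :: "'a pair_pre_digraph \<Rightarrow> 'a set \<Rightarrow> bool" where
  "minimum_determining_set G S \<longleftrightarrow> determining_set G S \<and> card S = determining_number G"

text \<open>\<open>Level s v\<^sub>i\<close> is the vertex \<open>u\<^sub>i\<^sup>s\<close>, so \<open>Level 0\<close> embeds \<open>G\<close>; \<open>Apex\<close> is \<open>w\<close>.\<close>

datatype 'a mycielskian_vertex = Level nat 'a | Apex

definition generalized_mycielskian ::
    "nat \<Rightarrow> 'a pair_pre_digraph \<Rightarrow> 'a mycielskian_vertex pair_pre_digraph" where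
  "generalized_mycielskian t G = \<lparr>
     pverts = {Level s v | s v. s \<le> t \<and> v \<in> pverts G} \<union> {Apex},
     parcs = {(Level 0 u, Level 0 v) | u v. (u, v) \<in> parcs G}
       \<union> {(Level s u, Level (Suc s) v) | s u v. s < t \<and> (u, v) \<in> parcs G}
       \<union> {(Level (Suc s) u, Level s v) | s u v. s < t \<and> (u, v) \<in> parcs G}
       \<union> {(Level t v, Apex) | v. v \<in> pverts G}
       \<union> {(Apex, Level t v) | v. v \<in> pverts G} \<rparr>"

lemma pair_graph_generalized_mycielskian:
  assumes "pair_graph G"
  shows "pair_graph (generalized_mycielskian t G)"
proof -
  interpret G: pair_graph G by fact
  let ?M = "generalized_mycielskian t G"
  have V: "pverts ?M = (\<lambda>(s, v). Level s v) ` ({..t} \<times> pverts G) \<union> {Apex}"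
    by (auto simp: generalized_mycielskian_def)
  have fin: "finite (pverts ?M)"
    unfolding V using G.pair_finite_verts by blast
  have sub: "parcs ?M \<subseteq> pverts ?M \<times> pverts ?M"
    by (auto simp: generalized_mycielskian_def dest: G.in_arcsD1 G.in_arcsD2)
  show ?thesis
  proof
    show "finite (parcs ?M)"
      using finite_subset[OF sub] fin by simp
    show "symmetric (with_proj ?M)"
      unfolding symmetric_def
      by (auto simp: generalized_mycielskian_def intro!: symI dest: G.arcs_symmetric)
    show "fst e \<noteq> snd e" if "e \<in> parcs ?M" for e
      using that by (auto simp: generalized_mycielskian_def dest: G.no_loops')
  qed (use sub fin in auto)
qed

end

theory Submission
  imports Defs
begin

text \<open>
  If an automorphism of \<open>\<mu>\<^sup>(\<^sup>t\<^sup>)(G)\<close> fixes \<open>w\<close>, it preserves the levels, since the level of a vertex is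
  determined by its distance to \<open>w\<close>; twin-freeness then forces it to act on all levels by one and
  the same automorphism of \<open>G\<close>. Determining sets of \<open>G\<close> and of \<open>\<mu>\<^sup>(\<^sup>t\<^sup>)(G)\<close> thus correspond via the
  projection that forgets the level.

  To see that \<open>w\<close> is fixed unless \<open>G = K\<^sub>2\<close>, suppose that an automorphism sends \<open>u\<^sub>x\<^sup>s\<close> to \<open>w\<close>, and let
  \<open>n\<close> be the number of vertices of \<open>G\<close>. If \<open>s < t\<close>, then \<open>n = 2k\<close> where \<open>k\<close> is the degree of \<open>x\<close>.
  The copies of \<open>x\<close> two levels above and below share all upper, respectively lower, neighbours with
  \<open>u\<^sub>x\<^sup>s\<close>, so they are sent to copies of vertices of degree at least \<open>k\<close> whose neighbourhoods cover
  \<open>G\<close>; hence \<open>x\<close> has a neighbour of degree at least \<open>k\<close>. Comparing degrees, every neighbour of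
  degree \<open>d\<close> of \<open>x\<close> yields a vertex of degree \<open>2d - 1\<close>. So some vertex has degree \<open>n - 1\<close>; if
  \<open>k > 1\<close>, it is a neighbour of \<open>x\<close> and yields a vertex of degree \<open>2(n - 1) - 1 \<ge> n\<close>, which is
  absurd. If \<open>s = t\<close>, then \<open>x\<close> is adjacent to all other vertices, and counting the vertices at
  distance two from \<open>u\<^sub>x\<^sup>t\<close> shows that \<open>G\<close> is a star, so \<open>n = 2\<close> by twin-freeness.

  For \<open>G = K\<^sub>2\<close> the graph \<open>\<mu>\<^sup>(\<^sup>t\<^sup>)(G)\<close> is an odd cycle, where the reflection through a vertex fixes
  only this vertex.
\<close>

subsection \<open>Automorphisms and determining sets\<close>

context
  fixes H :: "'b pair_pre_digraph" and f :: "'b \<Rightarrow> 'b"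
  assumes auto: "automorphism H f"
begin

lemma automorphism_bij: "bij_betw f (pverts H) (pverts H)"
  using auto by (simp add: automorphism_def)

lemma automorphism_inj_on: "A \<subseteq> pverts H \<Longrightarrow> inj_on f A"
  using automorphism_bij by (auto simp: bij_betw_def intro: inj_on_subset)

lemma automorphism_in_pverts: "p \<in> pverts H \<Longrightarrow> f p \<in> pverts H"
  using automorphism_bij by (auto simp: bij_betw_def)

lemma automorphism_eq_iff: "p \<in> pverts H \<Longrightarrow> q \<in> pverts H \<Longrightarrow> f p = f q \<longleftrightarrow> p = q"
  using automorphism_bij by (auto simp: bij_betw_def inj_on_def)

lemma automorphism_nbhd:
  assumes "pair_wf_digraph H" "p \<in> pverts H"
  shows "nbhd H (f p) = f ` nbhd H p"
proof -
  interpret H: pair_wf_digraph H by fact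
  have sub: "nbhd H q \<subseteq> pverts H" for q
    by (auto simp: nbhd_def dest: H.in_arcsD2)
  have arc: "f q \<in> nbhd H (f p) \<longleftrightarrow> q \<in> nbhd H p" if "q \<in> pverts H" for q
    using auto assms(2) that by (simp add: automorphism_def nbhd_def)
  show ?thesis
  proof
    show "f ` nbhd H p \<subseteq> nbhd H (f p)"
      using arc sub by blast
    show "nbhd H (f p) \<subseteq> f ` nbhd H p"
    proof
      fix r assume r: "r \<in> nbhd H (f p)"
      then have "r \<in> f ` pverts H"
        using sub automorphism_bij by (auto simp: bij_betw_def)
      then show "r \<in> f ` nbhd H p"
        using arc r by blast
    qed
  qed
qed

lemma automorphism_card_nbhd:
  assumes "pair_wf_digraph H" "p \<in> pverts H"
  shows "card (nbhd H (f p)) = card (nbhd H p)"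
proof -
  interpret H: pair_wf_digraph H by fact
  have "nbhd H p \<subseteq> pverts H"
    by (auto simp: nbhd_def dest: H.in_arcsD2)
  then show ?thesis
    by (simp add: automorphism_nbhd assms card_image automorphism_inj_on)
qed

end

lemma determining_set_pverts: "determining_set H (pverts H)"
  by (auto simp: determining_set_def)

lemma determining_number_le: "determining_set H S \<Longrightarrow> determining_number H \<le> card S"
  unfolding determining_number_def by (rule Least_le) blast

lemma ex_minimum_determining_set: "\<exists>S. minimum_determining_set H S"
  unfolding minimum_determining_set_def determining_number_def
  by (rule LeastI[of "\<lambda>k. \<exists>S. determining_set H S \<and> card S = k"])
    (use determining_set_pverts in blast)

subsection \<open>Structure of the Mycielskian\<close>

locale mycielskian = pair_graph G for G :: "'a pair_pre_digraph" +
  fixes t :: nat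
  assumes twin_free: "twin_free G"
    and no_isolated: "\<not> (\<exists>v. isolated G v)"
    and t_pos: "t \<ge> 1"
begin

abbreviation M :: "'a mycielskian_vertex pair_pre_digraph" where
  "M \<equiv> generalized_mycielskian t G"

lemma pair_graph_M: "pair_graph M"
  by (rule pair_graph_generalized_mycielskian) (rule pair_graph_axioms)

lemma wf_M: "pair_wf_digraph M"
proof -
  interpret M: pair_graph M by (rule pair_graph_M)
  show ?thesis by (rule M.pair_wf_digraph_axioms)
qed

lemma finite_pverts_M: "finite (pverts M)"
proof -
  interpret M: pair_graph M by (rule pair_graph_M)
  show ?thesis by (rule M.pair_finite_verts)
qed

lemma nbhd_M_subset: "nbhd M p \<subseteq> pverts M"
proof -
  interpret M: pair_graph M by (rule pair_graph_M)
  show ?thesis by (auto simp: nbhd_def dest: M.in_arcsD2)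
qed

lemma Level_in_pverts [simp]: "Level s v \<in> pverts M \<longleftrightarrow> s \<le> t \<and> v \<in> pverts G"
  and Apex_in_pverts [simp]: "Apex \<in> pverts M"
  by (auto simp: generalized_mycielskian_def)

lemma pverts_M_cases:
  assumes "p \<in> pverts M"
  obtains "p = Apex" | s v where "p = Level s v" "s \<le> t" "v \<in> pverts G"
  using assms by (auto simp: generalized_mycielskian_def)

lemma nbhd_subset: "nbhd G v \<subseteq> pverts G"
  by (auto simp: nbhd_def dest: in_arcsD2)

lemma finite_nbhd: "finite (nbhd G v)"
  using nbhd_subset pair_finite_verts by (rule finite_subset)

lemma nbhd_sym: "u \<in> nbhd G v \<longleftrightarrow> v \<in> nbhd G u"
  by (auto simp: nbhd_def dest: arcs_symmetric)

lemma nbhd_irrefl: "v \<notin> nbhd G v"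
  by (auto simp: nbhd_def dest: no_loops')

lemma nbhd_nonempty: "v \<in> pverts G \<Longrightarrow> nbhd G v \<noteq> {}"
  using no_isolated by (auto simp: isolated_def)

lemma nbhd_inject:
  "u \<in> pverts G \<Longrightarrow> v \<in> pverts G \<Longrightarrow> nbhd G u = nbhd G v \<Longrightarrow> u = v"
  using twin_free by (auto simp: twin_free_def twins_def)

lemma card_nbhd_less:
  assumes "v \<in> pverts G"
  shows "card (nbhd G v) < card (pverts G)"
  using nbhd_subset nbhd_irrefl assms pair_finite_verts by (metis psubsetI psubset_card_mono)

lemma nbhd_M_Apex: "nbhd M Apex = Level t ` pverts G"
  by (auto simp: generalized_mycielskian_def nbhd_def)

lemma nbhd_M_top: "v \<in> pverts G \<Longrightarrow> nbhd M (Level t v) = insert Apex (Level (t - 1) ` nbhd G v)"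
  using t_pos by (cases t) (auto simp: generalized_mycielskian_def nbhd_def)

text \<open>For \<open>s = 0\<close> the truncated \<open>s - 1 = 0\<close> is exactly the level of the lower neighbours.\<close>

lemma nbhd_M_Level:
  "s < t \<Longrightarrow> nbhd M (Level s v) = Level (Suc s) ` nbhd G v \<union> Level (s - 1) ` nbhd G v"
  by (cases s) (auto simp: generalized_mycielskian_def nbhd_def)

lemma Level_in_nbhd_M:
  "Level r u \<in> nbhd M (Level s v) \<longleftrightarrow>
    u \<in> nbhd G v \<and> (r = 0 \<and> s = 0 \<or> r = Suc s \<and> s < t \<or> s = Suc r \<and> r < t)"
  by (auto simp: generalized_mycielskian_def nbhd_def)

lemma Apex_in_nbhd_M: "Apex \<in> nbhd M (Level s v) \<longleftrightarrow> s = t \<and> v \<in> pverts G"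
  by (auto simp: generalized_mycielskian_def nbhd_def)

lemma card_Level: "card (Level s ` A) = card A"
  by (simp add: card_image inj_on_def)

lemma card_nbhd_M_top: "v \<in> pverts G \<Longrightarrow> card (nbhd M (Level t v)) = Suc (card (nbhd G v))"
  by (simp add: nbhd_M_top card_insert_if finite_nbhd card_Level image_iff)

lemma card_nbhd_M_Level:
  assumes "s < t"
  shows "card (nbhd M (Level s v)) = 2 * card (nbhd G v)"
proof -
  have "Level (Suc s) ` nbhd G v \<inter> Level (s - 1) ` nbhd G v = {}"
    by auto
  then show ?thesis
    using assms by (simp add: nbhd_M_Level card_Un_disjoint finite_nbhd card_Level)
qed

subsection \<open>The apex is fixed\<close>

context
  fixes \<alpha>
  assumes \<alpha>: "automorphism M \<alpha>"
begin

lemmas \<alpha>_nbhd = automorphism_nbhd[OF \<alpha> wf_M]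
  and \<alpha>_card_nbhd = automorphism_card_nbhd[OF \<alpha> wf_M]
  and \<alpha>_in_pverts = automorphism_in_pverts[OF \<alpha>]
  and \<alpha>_eq_iff = automorphism_eq_iff[OF \<alpha>]

text \<open>
  The only vertices at distance two from the apex lie on level \<open>t - 1\<close>, so the vertices sharing a
  neighbour with the preimage of the apex are mapped to that level.
\<close>

lemma image_at_level_below_top:
  assumes p: "p \<in> pverts M" "\<alpha> p = Apex"
    and q: "q \<in> pverts M" "q \<noteq> p"
    and C: "C \<noteq> {}" "C \<subseteq> nbhd M p" "C \<subseteq> nbhd M q"
  obtains v where "v \<in> pverts G" "\<alpha> q = Level (t - 1) v" "\<alpha> ` C \<subseteq> Level t ` nbhd G v"
    "card C \<le> card (nbhd G v)"
proof -
  have "\<alpha> q \<noteq> Apex"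
    using p q \<alpha>_eq_iff by metis
  then obtain s v where v: "\<alpha> q = Level s v" "s \<le> t" "v \<in> pverts G"
    using \<alpha>_in_pverts[OF q(1)] by (auto elim: pverts_M_cases)
  have sub1: "\<alpha> ` C \<subseteq> Level t ` pverts G"
    using \<alpha>_nbhd[OF p(1)] p C nbhd_M_Apex by auto
  have sub2: "\<alpha> ` C \<subseteq> nbhd M (Level s v)"
    using \<alpha>_nbhd[OF q(1)] C v by auto
  obtain c where c: "c \<in> C"
    using C(1) by blast
  then obtain u where "\<alpha> c = Level t u"
    using sub1 by blast
  then have "Level t u \<in> nbhd M (Level s v)"
    using c sub2 by (metis imageI subsetD)
  then have s: "s = t - 1"
    using t_pos v(2) by (simp add: Level_in_nbhd_M)
  have sub: "\<alpha> ` C \<subseteq> Level t ` nbhd G v"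
  proof
    fix b assume b: "b \<in> \<alpha> ` C"
    then obtain u where u: "b = Level t u"
      using sub1 by blast
    then have "u \<in> nbhd G v"
      using b sub2 Level_in_nbhd_M by blast
    then show "b \<in> Level t ` nbhd G v"
      using u by blast
  qed
  have "C \<subseteq> pverts M"
    using C(3) nbhd_M_subset by (rule subset_trans)
  then have "card C = card (\<alpha> ` C)"
    by (simp add: card_image automorphism_inj_on[OF \<alpha>])
  also have "\<dots> \<le> card (Level t ` nbhd G v)"
    using sub by (intro card_mono) (simp_all add: finite_nbhd)
  finally have "card C \<le> card (nbhd G v)"
    by (simp add: card_Level)
  then show ?thesis using that v s sub by blast
qed

text \<open>A neighbour of \<open>p\<close> is sent to level \<open>t\<close>. Passing from
  \<open>G\<close> to \<open>M\<close> doubles degrees below the top and raises them by one on level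
  \<open>t\<close>, so preservation of degrees gives the equation.\<close>

lemma degree_step:
  assumes "p \<in> pverts M" "\<alpha> p = Apex" "Level r y \<in> nbhd M p" "r < t"
  obtains v where "v \<in> pverts G" "Suc (card (nbhd G v)) = 2 * card (nbhd G y)"
proof -
  have y: "Level r y \<in> pverts M"
    using assms(3) nbhd_M_subset by blast
  obtain v where "v \<in> pverts G" "\<alpha> (Level r y) = Level t v"
    using \<alpha>_nbhd[OF assms(1)] assms(2,3) nbhd_M_Apex by auto
  with \<alpha>_card_nbhd[OF y] show ?thesis
    using that by (simp add: card_nbhd_M_top card_nbhd_M_Level assms(4))
qed

lemma two_vertices_if_Level_to_Apex:
  assumes s: "s < t" and x: "x \<in> pverts G" and image: "\<alpha> (Level s x) = Apex"
  shows "card (pverts G) = 2"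
proof -
  let ?k = "card (nbhd G x)" and ?p = "Level s x"
  have p: "?p \<in> pverts M"
    using s x by simp
  have nbhd_p: "nbhd M ?p = Level (Suc s) ` nbhd G x \<union> Level (s - 1) ` nbhd G x"
    using s by (rule nbhd_M_Level)
  have n: "card (pverts G) = 2 * ?k"
    using \<alpha>_card_nbhd[OF p] image s by (simp add: nbhd_M_Apex card_Level card_nbhd_M_Level)
  have k: "?k \<ge> 1"
    using nbhd_nonempty[OF x] finite_nbhd by (simp add: Suc_leI card_gt_0_iff)
  have step: "\<exists>v\<in>pverts G. Suc (card (nbhd G v)) = 2 * card (nbhd G y)" if "y \<in> nbhd G x" for y
  proof -
    have "Level (s - 1) y \<in> nbhd M ?p" "s - 1 < t"
      using that s nbhd_p by auto
    then show ?thesis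
      using degree_step[OF p image] by metis
  qed
  have share: "\<exists>v\<in>pverts G. \<alpha> ` Level r ` nbhd G x \<subseteq> Level t ` nbhd G v \<and> ?k \<le> card (nbhd G v)"
    if "q \<in> pverts M" "q \<noteq> ?p" "Level r ` nbhd G x \<subseteq> nbhd M q" "r \<in> {Suc s, s - 1}" for q r
  proof -
    have "Level r ` nbhd G x \<noteq> {}" "Level r ` nbhd G x \<subseteq> nbhd M ?p"
      using nbhd_nonempty[OF x] nbhd_p that(4) by auto
    from image_at_level_below_top[OF p image that(1,2) this that(3)] show ?thesis
      unfolding card_Level by metis
  qed
  \<comment> \<open>\<open>q1\<close> is a second vertex adjacent to all upper neighbours of
    \<open>?p\<close>: the copy of \<open>x\<close> two levels up, or the apex if these neighbours
    lie on level \<open>t\<close>.\<close>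
  define q1 where "q1 = (if Suc s = t then Apex else Level (Suc (Suc s)) x)"
  have q1: "q1 \<in> pverts M" "q1 \<noteq> ?p" "Level (Suc s) ` nbhd G x \<subseteq> nbhd M q1"
    using s x nbhd_subset by (auto simp: q1_def nbhd_M_Apex Level_in_nbhd_M)
  obtain v1 where v1: "v1 \<in> pverts G" "\<alpha> ` Level (Suc s) ` nbhd G x \<subseteq> Level t ` nbhd G v1"
    "?k \<le> card (nbhd G v1)"
    using share[OF q1] by blast
  \<comment> \<open>Likewise for the lower neighbours. If \<open>s\<close> is 0 or 1, these lie on
    level 0 and are adjacent to both \<open>Level 0 x\<close> and \<open>Level 1 x\<close>; the one
    distinct from \<open>?p\<close> is taken.\<close>
  define q2 where "q2 = (if s = 0 then Level 1 x else if s = 1 then Level 0 x else Level (s - 2) x)"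
  have q2: "q2 \<in> pverts M" "q2 \<noteq> ?p" "Level (s - 1) ` nbhd G x \<subseteq> nbhd M q2"
    using s x by (auto simp: q2_def Level_in_nbhd_M)
  obtain v2 where v2: "v2 \<in> pverts G" "\<alpha> ` Level (s - 1) ` nbhd G x \<subseteq> Level t ` nbhd G v2"
    "?k \<le> card (nbhd G v2)"
    using share[OF q2] by blast
  \<comment> \<open>Every neighbour of the apex is the image of an upper or a lower neighbour of
    \<open>?p\<close>, so the neighbourhoods of \<open>v1\<close> and \<open>v2\<close> cover
    \<open>G\<close>.\<close>
  have "Level t ` pverts G \<subseteq> Level t ` (nbhd G v1 \<union> nbhd G v2)"
    using \<alpha>_nbhd[OF p] v1(2) v2(2) by (simp add: image nbhd_M_Apex nbhd_p image_Un) blast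
  then have "x \<in> nbhd G v1 \<or> x \<in> nbhd G v2"
    using x by auto
  then obtain v where v: "v \<in> nbhd G x" "?k \<le> card (nbhd G v)"
    using v1(3) v2(3) nbhd_sym by blast
  obtain z where z: "z \<in> pverts G" "Suc (card (nbhd G z)) = 2 * card (nbhd G v)"
    using step[OF v(1)] by blast
  \<comment> \<open>Here \<open>2 * card (nbhd G v)\<close> is at least
    \<open>2 * ?k = card (pverts G)\<close>, so \<open>z\<close> has the largest possible
    degree.\<close>
  have deg_z: "Suc (card (nbhd G z)) = card (pverts G)"
    using card_nbhd_less[OF z(1)] z(2) v(2) n by linarith
  show ?thesis
  proof (cases "z = x")
    case True
    then show ?thesis using deg_z n by simp
  next
    case False
    have "nbhd G z = pverts G - {z}"
      using deg_z z(1) nbhd_subset nbhd_irrefl pair_finite_verts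
      by (intro card_subset_eq) auto
    then have "z \<in> nbhd G x"
      using False x nbhd_sym by auto
    then obtain z' where "z' \<in> pverts G" "Suc (card (nbhd G z')) = 2 * card (nbhd G z)"
      using step by blast
    then show ?thesis
      using card_nbhd_less[of z'] deg_z n k by linarith
  qed
qed

lemma two_vertices_if_top_to_Apex:
  assumes x: "x \<in> pverts G" and image: "\<alpha> (Level t x) = Apex"
  shows "card (pverts G) = 2"
proof -
  let ?p = "Level t x"
  have p: "?p \<in> pverts M"
    using x by simp
  have nbhd_p: "nbhd M ?p = insert Apex (Level (t - 1) ` nbhd G x)"
    using x by (rule nbhd_M_top)
  have "Suc (card (nbhd G x)) = card (pverts G)"
    using \<alpha>_card_nbhd[OF p] image x by (simp add: nbhd_M_Apex card_Level card_nbhd_M_top)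
  then have nbhd_x: "nbhd G x = pverts G - {x}"
    using x nbhd_subset nbhd_irrefl pair_finite_verts by (intro card_subset_eq) auto
  have leaf: "nbhd G y = {x}" if y: "y \<in> nbhd G x" for y
  proof (rule ccontr)
    assume contra: "nbhd G y \<noteq> {x}"
    have x_y: "x \<in> nbhd G y"
      using y nbhd_sym by blast
    with contra obtain z where z: "z \<in> nbhd G y" "z \<noteq> x"
      by blast
    then have z_x: "z \<in> nbhd G x"
      using nbhd_x nbhd_subset by blast
    \<comment> \<open>\<open>?Q\<close> has one vertex more than level \<open>t - 1\<close>, yet
      each shares a neighbour with \<open>?p\<close>: the apex, or the copy of \<open>y\<close> or
      \<open>z\<close> on level \<open>t - 1\<close>. For \<open>t = 1\<close> the truncated
      \<open>t - 2 = 0\<close> is right, since level 0 carries the edges of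
      \<open>G\<close>.\<close>
    let ?Q = "Level t ` (pverts G - {x}) \<union> {Level (t - 2) x, Level (t - 2) y}"
    have y_V: "y \<in> pverts G" "y \<noteq> x"
      using y nbhd_x by auto
    have low: "Level (t - 1) ` nbhd G u \<subseteq> nbhd M (Level (t - 2) u)" for u
      using t_pos by (auto simp: Level_in_nbhd_M)
    have share: "\<exists>C. C \<noteq> {} \<and> C \<subseteq> nbhd M ?p \<and> C \<subseteq> nbhd M q" if "q \<in> ?Q" for q
    proof -
      consider u where "q = Level t u" "u \<in> pverts G" "u \<noteq> x"
        | "q = Level (t - 2) x" | "q = Level (t - 2) y"
        using \<open>q \<in> ?Q\<close> by auto
      then show ?thesis
      proof cases
        case 1
        then show ?thesis by (intro exI[of _ "{Apex}"]) (simp add: nbhd_M_top x)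
      next
        case 2
        then show ?thesis using low[of x] y nbhd_p by (intro exI[of _ "{Level (t - 1) y}"]) auto
      next
        case 3
        then show ?thesis using low[of y] z z_x nbhd_p by (intro exI[of _ "{Level (t - 1) z}"]) auto
      qed
    qed
    have Q: "?Q \<subseteq> pverts M" "?p \<notin> ?Q"
      using x y_V t_pos by auto
    have "\<alpha> ` ?Q \<subseteq> Level (t - 1) ` pverts G"
    proof (rule image_subsetI)
      fix q assume q: "q \<in> ?Q"
      obtain C where C: "C \<noteq> {}" "C \<subseteq> nbhd M ?p" "C \<subseteq> nbhd M q"
        using share[OF q] by blast
      have "q \<in> pverts M" "q \<noteq> ?p"
        using q Q by blast+
      from image_at_level_below_top[OF p image this C]
      show "\<alpha> q \<in> Level (t - 1) ` pverts G"
        by (metis imageI)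
    qed
    then have "card (\<alpha> ` ?Q) \<le> card (Level (t - 1) ` pverts G)"
      using pair_finite_verts by (intro card_mono) simp_all
    moreover have "card (\<alpha> ` ?Q) = card ?Q"
      using automorphism_inj_on[OF \<alpha> Q(1)] by (rule card_image)
    moreover have "card ?Q = card (pverts G - {x}) + 2"
      using t_pos y_V pair_finite_verts
      by (subst card_Un_disjoint) (auto simp: card_Level)
    ultimately show False
      using x pair_finite_verts card_Suc_Diff1[of "pverts G" x] by (simp add: card_Level)
  qed
  obtain y where y: "y \<in> nbhd G x"
    using nbhd_nonempty[OF x] by blast
  \<comment> \<open>Any two neighbours of \<open>x\<close> are twins, both having neighbourhood
    \<open>{x}\<close>.\<close>
  have "z = y" if z: "z \<in> nbhd G x" for z
    using leaf[OF y] leaf[OF z] y z nbhd_subset[of x] by (intro nbhd_inject) auto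
  then have "nbhd G x = {y}"
    using y by blast
  moreover have "pverts G = insert x (nbhd G x)"
    unfolding nbhd_x using x by blast
  ultimately have "pverts G = {x, y}" "x \<noteq> y"
    using nbhd_irrefl[of x] by auto
  then show ?thesis by simp
qed

lemma Apex_fixed:
  assumes "card (pverts G) \<noteq> 2"
  shows "\<alpha> Apex = Apex"
proof -
  obtain p where "p \<in> pverts M" "\<alpha> p = Apex"
    using automorphism_bij[OF \<alpha>] Apex_in_pverts by (metis bij_betw_def imageE)
  then show ?thesis
  proof (cases p rule: pverts_M_cases)
    case (2 s x)
    then show ?thesis
      using assms two_vertices_if_Level_to_Apex[of s x] two_vertices_if_top_to_Apex[of x] \<open>\<alpha> p = Apex\<close>
      by (cases "s = t") auto
  qed simp
qed

end

subsection \<open>Automorphisms fixing the apex\<close>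

text \<open>For \<open>s \<le> t + 1\<close> this is the sphere of radius \<open>t + 1 - s\<close>
  around the apex; counting the apex as layer \<open>t + 1\<close> lets the recursion below start
  there.\<close>

definition layer :: "nat \<Rightarrow> 'a mycielskian_vertex set" where
  "layer s = (if s \<le> t then Level s ` pverts G else {Apex})"

text \<open>As layer \<open>s + 1\<close> is not level 0, its neighbours lie only in the two
  adjacent layers; without isolated vertices they exhaust layer \<open>s\<close>.\<close>

lemma layer_eq:
  assumes "s < t"
  shows "layer s = \<Union> (nbhd M ` layer (Suc s)) - layer (Suc (Suc s))"
proof (rule set_eqI)
  fix p
  have ex: "\<exists>u\<in>pverts G. v \<in> nbhd G u" if "v \<in> pverts G" for v
    using nbhd_nonempty[OF that] nbhd_subset nbhd_sym by blast
  show "p \<in> layer s \<longleftrightarrow> p \<in> \<Union> (nbhd M ` layer (Suc s)) - layer (Suc (Suc s))"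
  proof (cases p)
    case Apex
    have "Apex \<notin> nbhd M (Level (Suc s) v)" if "Suc s < t" for v
      using that by (auto simp: nbhd_M_Level)
    with Apex assms show ?thesis
      by (auto simp: layer_def)
  next
    case (Level r v)
    then show ?thesis
      using assms ex[of v] nbhd_subset by (auto simp: layer_def Level_in_nbhd_M)
  qed
qed

lemma image_layer:
  assumes \<alpha>: "automorphism M \<alpha>" and fix_Apex: "\<alpha> Apex = Apex" and "s \<le> t"
  shows "\<alpha> ` layer s = layer s"
proof -
  have sub: "layer s \<subseteq> pverts M" for s
    by (auto simp: layer_def)
  from \<open>s \<le> t\<close> have "\<alpha> ` layer s = layer s \<and> \<alpha> ` layer (Suc s) = layer (Suc s)"
  \<comment> \<open>The induction descends from \<open>t\<close> and carries two consecutive layers,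
    since \<open>layer_eq\<close> expresses each layer by the two above it.\<close>
  proof (induction rule: inc_induct)
    case base
    then show ?case
      using automorphism_nbhd[OF \<alpha> wf_M Apex_in_pverts] fix_Apex
      by (simp add: layer_def nbhd_M_Apex)
  next
    case (step s)
    have "\<alpha> ` (\<Union>p\<in>layer (Suc s). nbhd M p) = (\<Union>p\<in>layer (Suc s). nbhd M (\<alpha> p))"
      using automorphism_nbhd[OF \<alpha> wf_M] sub[of "Suc s"] by (simp add: image_UN subset_iff)
    also have "\<dots> = \<Union> (nbhd M ` \<alpha> ` layer (Suc s))"
      by simp
    also have "\<dots> = \<Union> (nbhd M ` layer (Suc s))"
      using step.IH by simp
    finally have "\<alpha> ` \<Union> (nbhd M ` layer (Suc s)) = \<Union> (nbhd M ` layer (Suc s))" .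
    moreover have "\<alpha> ` layer s
        = \<alpha> ` \<Union> (nbhd M ` layer (Suc s)) - \<alpha> ` layer (Suc (Suc s))"
      unfolding layer_eq[OF \<open>s < t\<close>]
      by (rule inj_on_image_set_diff[OF automorphism_inj_on[OF \<alpha> subset_refl]])
        (use nbhd_M_subset sub in blast)+
    ultimately show ?case
      using step.IH layer_eq[OF \<open>s < t\<close>] by simp
  qed
  then show ?thesis ..
qed

text \<open>
  The permutations induced on consecutive levels preserve adjacency between these levels, so in a
  twin-free graph each of them determines the next one.
\<close>

lemma automorphism_lifted:
  assumes \<alpha>: "automorphism M \<alpha>" and fix_Apex: "\<alpha> Apex = Apex"
  obtains f where "automorphism G f" "\<And>s v. s \<le> t \<Longrightarrow> v \<in> pverts G \<Longrightarrow> \<alpha> (Level s v) = Level s (f v)"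
proof -
  have "\<exists>u. u \<in> pverts G \<and> \<alpha> (Level s v) = Level s u" if "s \<le> t" "v \<in> pverts G" for s v
    using image_layer[OF \<alpha> fix_Apex that(1)] that by (auto simp: layer_def)
  then obtain a where a: "s \<le> t \<Longrightarrow> v \<in> pverts G \<Longrightarrow> a s v \<in> pverts G"
    "s \<le> t \<Longrightarrow> v \<in> pverts G \<Longrightarrow> \<alpha> (Level s v) = Level s (a s v)" for s v
    by metis
  have surj: "\<exists>u\<in>pverts G. v = a s u" if "s \<le> t" "v \<in> pverts G" for s v
  proof -
    have "Level s v \<in> \<alpha> ` layer s"
      using image_layer[OF \<alpha> fix_Apex that(1)] that by (simp add: layer_def)
    then show ?thesis
      using that(1) a(2) by (auto simp: layer_def)
  qed
  have adj: "a r u \<in> nbhd G (a s v) \<longleftrightarrow> u \<in> nbhd G v"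
    if "r = 0 \<and> s = 0 \<or> r = Suc s \<and> s < t" "u \<in> pverts G" "v \<in> pverts G" for r s u v
  proof -
    have le: "r \<le> t" "s \<le> t"
      using that(1) by auto
    have "\<alpha> (Level r u) \<in> nbhd M (\<alpha> (Level s v)) \<longleftrightarrow> Level r u \<in> nbhd M (Level s v)"
      using \<alpha> le that by (simp add: automorphism_def nbhd_def)
    then show ?thesis
      using that(1) le a(2)[of r u] a(2)[of s v] that(2,3) by (auto simp: Level_in_nbhd_M)
  qed
  have const: "a s v = a 0 v" if "s \<le> t" "v \<in> pverts G" for s v
    using that
  proof (induction s arbitrary: v)
    case (Suc s)
    \<comment> \<open>With \<open>u = a 0 u' = a s u'\<close>, both sides say that \<open>u'\<close>
      is adjacent to \<open>v\<close>; hence \<open>a (Suc s) v\<close> and \<open>a 0 v\<close>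
      have equal neighbourhoods.\<close>
    have "u \<in> nbhd G (a (Suc s) v) \<longleftrightarrow> u \<in> nbhd G (a 0 v)" if u: "u \<in> pverts G" for u
    proof -
      obtain u' where u': "u' \<in> pverts G" "u = a 0 u'"
        using surj[of 0 u] u by auto
      then have "u = a s u'"
        using Suc by simp
      then show ?thesis
        using adj[of "Suc s" s v u'] adj[of 0 0 v u'] u' Suc.prems nbhd_sym by auto
    qed
    then have "nbhd G (a (Suc s) v) = nbhd G (a 0 v)"
      using nbhd_subset by blast
    then show ?case
      using a(1) Suc.prems by (intro nbhd_inject) auto
  qed simp
  have "automorphism G (a 0)"
    unfolding automorphism_def
  proof (intro conjI ballI)
    have "inj_on (a 0) (pverts G)"
      using a(2)[of 0] automorphism_eq_iff[OF \<alpha>, of "Level 0 _" "Level 0 _"]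
      by (auto simp: inj_on_def)
    moreover have "a 0 ` pverts G = pverts G"
      using surj[of 0] a(1)[of 0] by auto
    ultimately show "bij_betw (a 0) (pverts G) (pverts G)"
      by (simp add: bij_betw_def)
    show "(a 0 u, a 0 v) \<in> parcs G \<longleftrightarrow> (u, v) \<in> parcs G" if "u \<in> pverts G" "v \<in> pverts G" for u v
      using adj[of 0 0 v u] that by (simp add: nbhd_def)
  qed
  then show ?thesis
    using that const a(2) by metis
qed

text \<open>Converse of \<open>automorphism_lifted\<close>: arcs between levels depend only on the
  levels and on adjacency in \<open>G\<close>, which \<open>f\<close> preserves.\<close>

lemma automorphism_map_mycielskian_vertex:
  assumes f: "automorphism G f"
  shows "automorphism M (map_mycielskian_vertex f)"
  unfolding automorphism_def
proof (intro conjI ballI)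
  let ?F = "map_mycielskian_vertex f"
  have bij: "bij_betw f (pverts G) (pverts G)"
    by (rule automorphism_bij[OF f])
  have "inj_on ?F (pverts M)"
    using automorphism_eq_iff[OF f] by (auto simp: inj_on_def elim!: pverts_M_cases)
  moreover have "?F ` pverts M \<subseteq> pverts M"
    using automorphism_in_pverts[OF f] by (auto elim!: pverts_M_cases)
  ultimately show "bij_betw ?F (pverts M) (pverts M)"
    using finite_pverts_M by (simp add: bij_betw_def endo_inj_surj)
  have nbhd: "f u \<in> nbhd G (f v) \<longleftrightarrow> u \<in> nbhd G v" if "u \<in> pverts G" "v \<in> pverts G" for u v
    using f that by (simp add: automorphism_def nbhd_def)
  have arc: "(p, q) \<in> parcs M \<longleftrightarrow> q \<in> nbhd M p" for p q
    by (simp add: nbhd_def)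
  fix p q assume "p \<in> pverts M" "q \<in> pverts M"
  then show "(?F p, ?F q) \<in> parcs M \<longleftrightarrow> (p, q) \<in> parcs M"
    unfolding arc
    using nbhd automorphism_in_pverts[OF f]
    by (elim pverts_M_cases) (auto simp: nbhd_M_Apex Level_in_nbhd_M Apex_in_nbhd_M)
qed

subsection \<open>Determining sets\<close>

text \<open>Once the apex is fixed, \<open>automorphism_lifted\<close> yields one \<open>f\<close>
  for all levels, and \<open>f\<close> fixes \<open>S\<close>. The last hypothesis is met by
  \<open>Apex_fixed\<close> in general, and by putting the apex into \<open>T\<close> for two
  vertices.\<close>

lemma determining_set_lift:
  assumes S: "determining_set G S" and T: "T \<subseteq> pverts M" "Level 0 ` S \<subseteq> T"
    and fixes_Apex: "\<And>\<alpha>. automorphism M \<alpha> \<Longrightarrow> \<forall>p\<in>T. \<alpha> p = p \<Longrightarrow> \<alpha> Apex = Apex"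
  shows "determining_set M T"
  unfolding determining_set_def
proof (intro conjI allI impI)
  fix \<alpha> assume \<alpha>: "automorphism M \<alpha> \<and> (\<forall>p\<in>T. \<alpha> p = p)"
  then have Apex: "\<alpha> Apex = Apex"
    using fixes_Apex by blast
  with \<alpha> obtain f where f: "automorphism G f"
    "\<And>s v. s \<le> t \<Longrightarrow> v \<in> pverts G \<Longrightarrow> \<alpha> (Level s v) = Level s (f v)"
    using automorphism_lifted by blast
  have "f v = v" if "v \<in> S" for v
  proof -
    have "v \<in> pverts G" "Level 0 v \<in> T"
      using S T(2) that by (auto simp: determining_set_def)
    then show ?thesis
      using \<alpha> f(2)[of 0 v] by simp
  qed
  then have "\<forall>v\<in>pverts G. f v = v"
    using S f(1) unfolding determining_set_def by blast
  with Apex f(2) show "\<forall>p\<in>pverts M. \<alpha> p = p"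
    by (auto elim!: pverts_M_cases)
qed (rule T(1))

text \<open>\<open>S\<close> forgets the levels in \<open>T\<close>. If \<open>f\<close> fixes
  \<open>S\<close>, its lift fixes \<open>T\<close>, and the apex in any case, so the apex need not
  be counted.\<close>

lemma determining_set_project:
  assumes T: "determining_set M T"
  obtains S where "determining_set G S" "card S \<le> card (T - {Apex})"
proof
  define S where "S = (\<lambda>p. case p of Level s v \<Rightarrow> v) ` (T - {Apex})"
  have sub: "T \<subseteq> pverts M"
    using T by (simp add: determining_set_def)
  then show "card S \<le> card (T - {Apex})"
    unfolding S_def using finite_pverts_M by (intro card_image_le) (auto intro: finite_subset)
  have mem: "v \<in> S" if "Level s v \<in> T" for s v
    using that unfolding S_def by (force intro: rev_image_eqI)
  show "determining_set G S"
    unfolding determining_set_def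
  proof (intro conjI allI impI)
    show "S \<subseteq> pverts G"
    proof
      fix v assume "v \<in> S"
      then obtain p where p: "p \<in> T - {Apex}" "v = (case p of Level s v \<Rightarrow> v)"
        unfolding S_def by blast
      then show "v \<in> pverts G"
        using sub by (cases p) auto
    qed
    fix f assume f: "automorphism G f \<and> (\<forall>v\<in>S. f v = v)"
    have "map_mycielskian_vertex f p = p" if "p \<in> T" for p
      using f mem that by (cases p) auto
    moreover have "automorphism M (map_mycielskian_vertex f)"
      using f automorphism_map_mycielskian_vertex by blast
    ultimately have "\<forall>p\<in>pverts M. map_mycielskian_vertex f p = p"
      using T unfolding determining_set_def by blast
    then show "\<forall>v\<in>pverts G. f v = v"
      by (metis Level_in_pverts le0 mycielskian_vertex.inject mycielskian_vertex.map(1))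
  qed
qed

lemma determining_number_le_M: "determining_number G \<le> determining_number M"
proof -
  obtain T where T: "determining_set M T" "card T = determining_number M"
    using ex_minimum_determining_set[of M] by (auto simp: minimum_determining_set_def)
  obtain S where "determining_set G S" "card S \<le> card (T - {Apex})"
    using determining_set_project[OF T(1)] by blast
  moreover have "card (T - {Apex}) \<le> card T"
    by (rule card_Diff1_le)
  ultimately show ?thesis
    using determining_number_le[of G S] T(2) by linarith
qed

lemma determining_number_M:
  assumes "card (pverts G) \<noteq> 2"
  shows "determining_number M = determining_number G"
    and "minimum_determining_set G S \<Longrightarrow> minimum_determining_set M (Level 0 ` S)"
proof -
  have lift: "determining_set M (Level 0 ` S)" if "determining_set G S" for S
    using that by (intro determining_set_lift[OF that] Apex_fixed[OF _ assms])
      (auto simp: determining_set_def)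
  show number: "determining_number M = determining_number G"
  proof (rule antisym)
    obtain S where S: "determining_set G S" "card S = determining_number G"
      using ex_minimum_determining_set[of G] by (auto simp: minimum_determining_set_def)
    show "determining_number M \<le> determining_number G"
      using determining_number_le[OF lift[OF S(1)]] S(2) by (simp add: card_Level)
  qed (rule determining_number_le_M)
  show "minimum_determining_set M (Level 0 ` S)" if "minimum_determining_set G S"
    using that lift by (simp add: minimum_determining_set_def number card_Level)
qed

subsection \<open>The complete graph on two vertices\<close>

context
  fixes a b
  assumes V: "pverts G = {a, b}" and a_neq_b: "a \<noteq> b"
begin

lemma nbhd_K2: "nbhd G a = {b}" "nbhd G b = {a}"
  using V nbhd_nonempty[of a] nbhd_nonempty[of b] nbhd_subset[of a] nbhd_subset[of b]
    nbhd_irrefl[of a] nbhd_irrefl[of b] by auto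

lemma determining_set_K2: "determining_set G {a}"
  unfolding determining_set_def
proof (intro conjI allI impI)
  fix f assume f: "automorphism G f \<and> (\<forall>v\<in>{a}. f v = v)"
  then show "\<forall>v\<in>pverts G. f v = v"
    using automorphism_in_pverts[of G f b] automorphism_eq_iff[of G f a b] V a_neq_b by auto
qed (simp add: V)

lemma determining_number_K2: "determining_number G = 1"
proof (rule antisym)
  show "determining_number G \<le> 1"
    using determining_number_le[OF determining_set_K2] by simp
  obtain S where S: "determining_set G S" "card S = determining_number G"
    using ex_minimum_determining_set[of G] by (auto simp: minimum_determining_set_def)
  have "S \<noteq> {}"
  proof
    assume "S = {}"
    let ?f = "\<lambda>v. if v = a then b else a"
    have "(a, b) \<in> parcs G" "(b, a) \<in> parcs G" "(a, a) \<notin> parcs G" "(b, b) \<notin> parcs G"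
      using nbhd_K2 a_neq_b by (auto simp: nbhd_def)
    then have "automorphism G ?f"
      using a_neq_b by (auto simp: automorphism_def V bij_betw_def inj_on_def)
    then have "?f a = a"
      using S(1) \<open>S = {}\<close> V unfolding determining_set_def by blast
    then show False
      using a_neq_b by simp
  qed
  moreover have "finite S"
    using S(1) pair_finite_verts by (auto simp: determining_set_def intro: finite_subset)
  ultimately show "1 \<le> determining_number G"
    using S(2) by (simp add: Suc_leI card_gt_0_iff flip: S(2))
qed

text \<open>
  \<open>M\<close> is the cycle of length \<open>2 * t + 3\<close>: starting at the apex it descends to level \<open>0\<close>,
  alternating between \<open>a\<close> and \<open>b\<close>, and climbs back to the apex along the remaining vertices.
\<close>

fun position :: "'a mycielskian_vertex \<Rightarrow> int" where
  "position Apex = 0"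
| "position (Level s v) = (if even (t + s) \<longleftrightarrow> v = a then int t + 1 - int s else int t + 2 + int s)"

abbreviation N :: int where
  "N \<equiv> 2 * int t + 3"

lemma position_bounds: "p \<in> pverts M \<Longrightarrow> 0 \<le> position p \<and> position p < N"
  by (cases p) auto

lemma position_inj: "inj_on position (pverts M)"
  using V a_neq_b by (auto simp: inj_on_def elim!: pverts_M_cases split: if_splits)

lemma position_surj:
  assumes "0 \<le> i" "i < N"
  obtains p where "p \<in> pverts M" "position p = i"
proof -
  \<comment> \<open>Around the cycle, \<open>a\<close> occupies the odd positions and
    \<open>b\<close> the even nonzero ones.\<close>
  define c where "c = (if odd i then a else b)"
  have c: "c \<in> pverts G" "c = a \<longleftrightarrow> odd i"
    using a_neq_b V by (auto simp: c_def)
  consider "i = 0" | "1 \<le> i" "i \<le> int t + 1" | "int t + 2 \<le> i"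
    using assms(1) by force
  then show ?thesis
  proof cases
    case 1
    then show ?thesis using that[of Apex] by simp
  next
    case 2
    define s where "s = nat (int t + 1 - i)"
    have s: "int s = int t + 1 - i"
      using 2 by (simp add: s_def)
    then have "i = int t + 1 - int s"
      by simp
    then have "even (t + s) \<longleftrightarrow> odd i" "s \<le> t"
      using 2 by auto
    then show ?thesis
      using that[of "Level s c"] c s by simp
  next
    case 3
    define s where "s = nat (i - int t - 2)"
    have s: "int s = i - int t - 2"
      using 3 by (simp add: s_def)
    then have "i = int t + 2 + int s"
      by simp
    then have "even (t + s) \<longleftrightarrow> even i" "s \<le> t"
      using assms by auto
    then show ?thesis
      using that[of "Level s c"] c s by simp
  qed
qed

text \<open>Only the multiples 0 and \<open>n\<close> or \<open>- n\<close> are in range: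
  \<open>1\<close> and \<open>- 1\<close> are ordinary steps, the other two values wrap around the
  cycle.\<close>

lemma consecutive_mod_iff:
  fixes d n :: int
  assumes "- n < d" "d < n"
  shows "n dvd d - 1 \<or> n dvd d + 1 \<longleftrightarrow> d \<in> {1, - 1, n - 1, 1 - n}"
proof
  assume "n dvd d - 1 \<or> n dvd d + 1"
  then show "d \<in> {1, - 1, n - 1, 1 - n}"
  proof
    assume dvd: "n dvd d - 1"
    then have "n dvd 1 - d"
      by (metis dvd_minus_iff minus_diff_eq)
    then show ?thesis
      using assms zdvd_imp_le[OF dvd] zdvd_imp_le[of n "1 - d"] by force
  next
    assume dvd: "n dvd d + 1"
    then have "n dvd - d - 1"
      by (metis dvd_minus_iff minus_add_distrib uminus_add_conv_diff diff_minus_eq_add add.commute)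
    then show ?thesis
      using assms zdvd_imp_le[OF dvd] zdvd_imp_le[of n "- d - 1"] by force
  qed
qed auto

text \<open>The first part treats two vertices on the same side of the cycle, the second opposite
  sides, which meet only in the edge on level 0. The parity conditions encode that one vertex is a
  copy of \<open>a\<close> and the other of \<open>b\<close>.\<close>

lemma levels_consecutive_iff:
  fixes r s :: nat and d :: int
  assumes "r \<le> t" "s \<le> t"
  shows "d \<in> {int s - int r, int r - int s} \<Longrightarrow>
      d \<in> {1, - 1, N - 1, 1 - N} \<longleftrightarrow> even (t + r) \<noteq> even (t + s) \<and>
        (s = 0 \<and> r = 0 \<or> s = Suc r \<and> r < t \<or> r = Suc s \<and> s < t)"
      (is "_ \<Longrightarrow> ?cyclic \<longleftrightarrow> ?odd")
    and "d \<in> {int s + int r + 1, - int s - int r - 1} \<Longrightarrow>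
      d \<in> {1, - 1, N - 1, 1 - N} \<longleftrightarrow> even (t + r) = even (t + s) \<and>
        (s = 0 \<and> r = 0 \<or> s = Suc r \<and> r < t \<or> r = Suc s \<and> s < t)"
      (is "_ \<Longrightarrow> _ \<longleftrightarrow> ?even")
proof -
  assume "d \<in> {int s - int r, int r - int s}"
  then have "d = int s - int r \<or> d = int r - int s"
    by simp
  then have "?cyclic \<longleftrightarrow> s = Suc r \<or> r = Suc s"
    using assms by (elim disjE) auto
  moreover have "s = Suc r \<or> r = Suc s \<longleftrightarrow> ?odd"
    using assms by auto
  ultimately show "?cyclic \<longleftrightarrow> ?odd"
    by (rule trans)
next
  assume "d \<in> {int s + int r + 1, - int s - int r - 1}"
  then have "d = int s + int r + 1 \<or> d = - int s - int r - 1"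
    by simp
  then have "?cyclic \<longleftrightarrow> s = 0 \<and> r = 0"
    using assms by (elim disjE) auto
  moreover have "s = 0 \<and> r = 0 \<longleftrightarrow> ?even"
    by auto
  ultimately show "?cyclic \<longleftrightarrow> ?even"
    by (rule trans)
qed

lemma adjacent_iff_consecutive:
  assumes "p \<in> pverts M" "q \<in> pverts M"
  shows "(p, q) \<in> parcs M \<longleftrightarrow>
    N dvd position p - position q - 1 \<or> N dvd position p - position q + 1"
proof -
  have arc: "(p, q) \<in> parcs M \<longleftrightarrow> q \<in> nbhd M p"
    by (simp add: nbhd_def)
  have bounds: "- N < position p - position q" "position p - position q < N"
    using position_bounds[OF assms(1)] position_bounds[OF assms(2)] by linarith+
  have "q \<in> nbhd M p \<longleftrightarrow> position p - position q \<in> {1, - 1, N - 1, 1 - N}"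
  proof (cases p)
    case Apex
    then show ?thesis
      using assms V a_neq_b by (cases q) (auto simp: nbhd_M_Apex)
  next
    case (Level r u)
    show ?thesis
    proof (cases q)
      case Apex
      then show ?thesis
        using assms Level V a_neq_b by (auto simp: Apex_in_nbhd_M)
    next
      case q: (Level s v)
      have le: "r \<le> t" "s \<le> t" and uv: "u = a \<or> u = b" "v = a \<or> v = b"
        using assms Level q V by auto
      have nbhd: "v \<in> nbhd G u \<longleftrightarrow> (u = a) \<noteq> (v = a)"
        using uv nbhd_K2 a_neq_b by auto
      show ?thesis
      proof (cases "(even (t + r) \<longleftrightarrow> u = a) \<longleftrightarrow> (even (t + s) \<longleftrightarrow> v = a)")
        case True
        then have "position p - position q \<in> {int s - int r, int r - int s}"
          unfolding Level q position.simps
          by (cases "even (t + r) \<longleftrightarrow> u = a"; cases "even (t + s) \<longleftrightarrow> v = a") simp_all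
        from levels_consecutive_iff(1)[OF le this] show ?thesis
          using True by (auto simp only: Level q Level_in_nbhd_M nbhd)
      next
        case False
        then have "position p - position q \<in> {int s + int r + 1, - int s - int r - 1}"
          unfolding Level q position.simps
          by (cases "even (t + r) \<longleftrightarrow> u = a"; cases "even (t + s) \<longleftrightarrow> v = a") simp_all
        from levels_consecutive_iff(2)[OF le this] show ?thesis
          using False by (auto simp only: Level q Level_in_nbhd_M nbhd)
      qed
    qed
  qed
  then show ?thesis
    by (simp only: arc consecutive_mod_iff[OF bounds])
qed

text \<open>The map sends position \<open>i\<close> to \<open>2 * position p - i\<close> modulo
  \<open>N\<close>. A fixed \<open>q\<close> has twice its distance to \<open>p\<close> divisible by
  \<open>N\<close>, and \<open>N\<close> is odd.\<close>

lemma reflection: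
  assumes p: "p \<in> pverts M"
  obtains f where "automorphism M f" "f p = p" "\<And>q. q \<in> pverts M \<Longrightarrow> f q = q \<Longrightarrow> q = p"
proof -
  have "\<exists>r. r \<in> pverts M \<and> position r = (2 * position p - position q) mod N" for q
    using position_surj[of "(2 * position p - position q) mod N"] by auto
  then obtain f where f: "f q \<in> pverts M" "position (f q) = (2 * position p - position q) mod N" for q
    by metis
  have eq: "q = r" if "q \<in> pverts M" "r \<in> pverts M" "N dvd position q - position r" for q r
  proof -
    have "position q mod N = position r mod N"
      using that(3) by (simp add: mod_eq_dvd_iff)
    then have "position q = position r"
      using position_bounds that(1,2) by simp
    then show ?thesis
      using position_inj that(1,2) by (auto simp: inj_on_def)
  qed
  have diff: "N dvd (position (f q) - position (f r)) - (position r - position q)" for q r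
  proof -
    have "(position (f q) - position (f r)) mod N = (position r - position q) mod N"
      unfolding f(2) by (simp add: mod_diff_eq)
    then show ?thesis by (simp add: mod_eq_dvd_iff)
  qed
  have shift: "N dvd x + c \<longleftrightarrow> N dvd y + c" if "N dvd x - y" for x y c
    using dvd_add_right_iff[OF that, of "y + c"] by (simp add: algebra_simps)
  have "inj_on f (pverts M)"
  proof (rule inj_onI)
    fix q r assume "q \<in> pverts M" "r \<in> pverts M" "f q = f r"
    then show "q = r"
      using diff[of r q] eq[of r q] by simp
  qed
  moreover have "f ` pverts M \<subseteq> pverts M"
    using f(1) by blast
  ultimately have "bij_betw f (pverts M) (pverts M)"
    using finite_pverts_M by (simp add: bij_betw_def endo_inj_surj)
  moreover have "(f q, f r) \<in> parcs M \<longleftrightarrow> (q, r) \<in> parcs M"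
    if qr: "q \<in> pverts M" "r \<in> pverts M" for q r
  proof -
    \<comment> \<open>The reflection negates differences of positions, which merely swaps the two
      disjuncts describing adjacency.\<close>
    have neg: "N dvd position r - position q + c \<longleftrightarrow> N dvd position q - position r - c" for c
      using dvd_minus_iff[of N "position q - position r - c"] by (simp add: algebra_simps)
    show ?thesis
      unfolding adjacent_iff_consecutive[OF f(1) f(1)] adjacent_iff_consecutive[OF qr]
      using shift[OF diff, of q r "- 1"] shift[OF diff, of q r 1] neg[of 1] neg[of "- 1"] by auto
  qed
  ultimately have "automorphism M f"
    by (simp add: automorphism_def)
  moreover have "f p = p"
    using eq[OF f(1) p, of p] position_bounds[OF p] f(2)[of p] by simp
  moreover have "q = p" if q: "q \<in> pverts M" "f q = q" for q
  proof -
    have "position q = (2 * position p - position q) mod N"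
      using f(2)[of q] q(2) by simp
    then have "position q mod N = (2 * position p - position q) mod N"
      by (metis mod_mod_trivial)
    then have "N dvd 2 * (position q - position p)"
      by (simp add: mod_eq_dvd_iff algebra_simps)
    moreover have "coprime N 2"
      by simp
    ultimately have "N dvd position q - position p"
      using coprime_dvd_mult_right_iff by blast
    then show ?thesis
      using eq q(1) p by blast
  qed
  ultimately show ?thesis
    using that by blast
qed

lemma determining_number_M_K2: "determining_number M = 2"
proof (rule antisym)
  have "determining_set M {Apex, Level 0 a}"
    by (rule determining_set_lift[OF determining_set_K2]) (auto simp: V)
  then show "determining_number M \<le> 2"
    using determining_number_le by fastforce
  obtain T where T: "determining_set M T" "card T = determining_number M"
    using ex_minimum_determining_set[of M] by (auto simp: minimum_determining_set_def)
  show "2 \<le> determining_number M"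
  proof (rule ccontr)
    assume "\<not> 2 \<le> determining_number M"
    then have "card T \<le> 1"
      using T(2) by simp
    moreover have sub: "T \<subseteq> pverts M"
      using T(1) by (simp add: determining_set_def)
    moreover have "finite T"
      using sub finite_pverts_M by (rule finite_subset)
    ultimately have "T = {} \<or> (\<exists>p. T = {p})"
      by (metis One_nat_def card_1_singletonE card_0_eq le_Suc_eq le_zero_eq)
    \<comment> \<open>For empty \<open>T\<close> the apex can serve as \<open>p\<close>.\<close>
    then obtain p where p: "p \<in> pverts M" "T \<subseteq> {p}"
      using \<open>T \<subseteq> pverts M\<close> Apex_in_pverts by blast
    obtain f where f: "automorphism M f" "f p = p" "\<And>q. q \<in> pverts M \<Longrightarrow> f q = q \<Longrightarrow> q = p"
      using reflection[OF p(1)] by blast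
    have "\<forall>q\<in>pverts M. f q = q"
      using T(1) f(1,2) p(2) unfolding determining_set_def by blast
    then have "pverts M \<subseteq> {p}"
      using f(3) by blast
    moreover have "Apex \<in> pverts M" "Level 0 a \<in> pverts M"
      using V by auto
    ultimately show False
      by (metis mycielskian_vertex.distinct(1) singletonD subsetD)
  qed
qed

end

text \<open>Without isolated vertices, the two vertices of a graph of order two must be
  adjacent.\<close>

lemma complete_digraph_iff_card: "complete_digraph 2 (with_proj G) \<longleftrightarrow> card (pverts G) = 2"
proof
  assume "card (pverts G) = 2"
  then obtain a b where V: "pverts G = {a, b}" "a \<noteq> b"
    by (auto simp: card_2_iff)
  have "(a, b) \<in> parcs G" "(b, a) \<in> parcs G"
    using nbhd_K2[OF V] by (auto simp: nbhd_def)
  then have "parcs G = {(u, v). (u, v) \<in> pverts G \<times> pverts G \<and> u \<noteq> v}"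
    using V by (auto dest: no_loops' in_arcsD1 in_arcsD2)
  then show "complete_digraph 2 (with_proj G)"
    using V graph_axioms by (simp add: complete_digraph_def)
qed (simp add: complete_digraph_def)

end

theorem theorem2:
  fixes G :: "'a pair_pre_digraph" and t :: nat
  assumes "pair_graph G"
    and "twin_free G"
    and "\<not> (\<exists>v. isolated G v)"
    and "t \<ge> 1"
  shows "(complete_digraph 2 (with_proj G) \<longrightarrow>
            determining_number G = 1 \<and>
            determining_number (generalized_mycielskian t G) = 2) \<and>
         (\<not> complete_digraph 2 (with_proj G) \<longrightarrow>
            (\<forall>S. minimum_determining_set G S \<longrightarrow>
                 minimum_determining_set (generalized_mycielskian t G) (Level 0 ` S)) \<and>
            determining_number (generalized_mycielskian t G) = determining_number G)"
proof -
  interpret mycielskian G t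
    using assms by (simp add: mycielskian_def mycielskian_axioms_def)
  show ?thesis
  proof (cases "card (pverts G) = 2")
    case True
    then obtain a b where "pverts G = {a, b}" "a \<noteq> b"
      by (auto simp: card_2_iff)
    with determining_number_K2 determining_number_M_K2 show ?thesis
      by (simp add: complete_digraph_iff_card)
  next
    case False
    with determining_number_M show ?thesis
      by (simp add: complete_digraph_iff_card)
  qed
qed

end
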